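(* Let $x^0=(\bar x^0,0)\in H$, let $b^\pm$ be continuous in $(t,x)$, and suppose that for some $T>0$, $\delta>0$, $c>0$ one of the following conditions holds: (A3) for all $t\in[0,T]$ and all $x\in\mathbb{R}^d\setminus H$ with $|x-x^0|\le\delta$: $\operatorname{sgn}(x_d)\,b_d(t,x)\le -c$; (A3$_+$) for all $t\in[0,T]$: $b_d^+(t,x)\le -c$ for all $x$ with $x_d>0$, $|x-x^0|\le\delta$, and $b_d^-(t,x)=0$ for all $x\in H$ with $|x-x^0|\le\delta$; (A3$_-$) for all $t\in[0,T]$: $b_d^-(t,x)\ge c$ for all $x$ with $x_d<0$, $|x-x^0|\le\delta$, and $b_d^+(t,x)=0$ for all $x\in H$ with $|x-x^0|\le\delta$. Set $$p^\pm(s,\bar x)=\frac{|b_d^\pm(s,(\bar x,0))|}{|b_d^-(s,(\bar x,0))|+|b_d^+(s,(\bar x,0))|}.$$ Let $\bar X^0(t)\in\mathbb{R}^{d-1}$ be the solution of the ordinary differential equation $$\bar X^0(t)=\bar x^0+\int_0^t\Big(\bar b^+(s,(\bar X^0(s),0))\,p^-(s,\bar X^0(s))+\bar b^-(s,(\bar X^0(s),0))\,p^+(s,\bar X^0(s))\Big)ds,\quad t\in[0,\sigma_\delta(X^0)\wedge T],$$ where $X^0=(\bar X^0,0)$ and $\sigma_\delta(X^0)=\inf\{t\ge0:\ |X^0(t)-x^0|\ge\delta\}$. Then $$X^\varepsilon(\cdot\wedge\sigma_\delta(X^0)\wedge T)\to\big(\bar X^0(\cdot\wedge\sigma_\delta(X^0)\wedge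 T),\,0\big),\quad \varepsilon\to0,$$ in probability, in $C([0,\infty),\mathbb{R}^d)$.
   Context: Write $x=(x_1,\dots,x_d)=(\bar x,x_d)\in\mathbb{R}^d$ with $\bar x\in\mathbb{R}^{d-1}$, and $H=\{x\in\mathbb{R}^d: x_d=0\}$. The functions $b^\pm=(\bar b^\pm,b_d^\pm):[0,\infty)\times\mathbb{R}^d\to\mathbb{R}^d$ are measurable, locally bounded, and satisfy a Lipschitz condition in $x$ on $\mathbb{R}^d$ (with constant independent of $t$). Set $b(t,x)=b^+(t,x)\mathbf 1_{x_d\ge0}+b^-(t,x)\mathbf 1_{x_d<0}$, with $d$-th coordinate $b_d$. For $\varepsilon>0$, $X^\varepsilon$ is the unique strong solution of $$X^\varepsilon(t)=x^0+\int_0^t b(s,X^\varepsilon(s))\,ds+\varepsilon w(t),\quad t\ge0,$$ where $w$ is a $d$-dimensional Wiener process. The space $C([0,\infty),\mathbb{R}^d)$ carries the topology of uniform convergence on compact sets; $a\wedge b=\min(a,b)$. *)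

theory Defs
  imports "HOL-Probability.Probability"
begin

unbundle lipschitz_syntax

text \<open>
  The space \<open>\<real>\<^sup>d\<close> is \<^typ>\<open>real ^ 'd\<close>, and \<open>k :: 'd\<close> is the index of the distinguished
  (``d-th'') coordinate. Since \<open>'d\<close> may have just one element, \<open>d = 1\<close> is included.
  A point \<open>v\<close> of \<open>\<real>\<^sup>d\<^sup>-\<^sup>1\<close> is identified with the point \<open>(v, 0)\<close> of the hyperplane (there is
  no type \<open>real ^ 'n\<close> of dimension \<open>0\<close>); accordingly \<open>bar k x\<close> is the vector of the first
  \<open>d - 1\<close> coordinates of \<open>x\<close>, read as an element of the hyperplane.
\<close>

definition hyperplane :: "'d::finite \<Rightarrow> (real ^ 'd) set" where
  "hyperplane k = {x. x $ k = 0}"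

definition bar :: "'d::finite \<Rightarrow> real ^ 'd \<Rightarrow> real ^ 'd" where
  "bar k x = (\<chi> i. if i = k then 0 else x $ i)"


subsection \<open>Coefficients\<close>

definition locally_bounded_coeff :: "(real \<Rightarrow> real ^ 'd \<Rightarrow> real ^ 'd::finite) \<Rightarrow> bool" where
  "locally_bounded_coeff b \<longleftrightarrow>
     (\<forall>K. compact K \<and> K \<subseteq> {0..} \<times> UNIV \<longrightarrow> bounded ((\<lambda>(t, x). b t x) ` K))"

definition drift_coeff :: "(real \<Rightarrow> real ^ 'd \<Rightarrow> real ^ 'd::finite) \<Rightarrow> bool" where
  "drift_coeff b \<longleftrightarrow>
     (\<lambda>(t, x). b t x) \<in> borel_measurable (restrict_space borel ({0..} \<times> UNIV)) \<and>
     locally_bounded_coeff b \<and>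
     (\<exists>L. \<forall>t\<ge>0. L-lipschitz_on UNIV (b t))"

definition glued_drift ::
  "'d::finite \<Rightarrow> (real \<Rightarrow> real ^ 'd \<Rightarrow> real ^ 'd) \<Rightarrow> (real \<Rightarrow> real ^ 'd \<Rightarrow> real ^ 'd)
    \<Rightarrow> real \<Rightarrow> real ^ 'd \<Rightarrow> real ^ 'd" where
  "glued_drift k bp bm t x = (if x $ k \<ge> 0 then bp t x else bm t x)"

definition cond_A3 ::
  "'d::finite \<Rightarrow> (real \<Rightarrow> real ^ 'd \<Rightarrow> real ^ 'd) \<Rightarrow> (real \<Rightarrow> real ^ 'd \<Rightarrow> real ^ 'd)
    \<Rightarrow> real ^ 'd \<Rightarrow> real \<Rightarrow> real \<Rightarrow> real \<Rightarrow> bool" where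
  "cond_A3 k bp bm x0 T \<delta> c \<longleftrightarrow>
     (\<forall>t\<in>{0..T}. \<forall>x. x \<notin> hyperplane k \<and> norm (x - x0) \<le> \<delta> \<longrightarrow>
        sgn (x $ k) * glued_drift k bp bm t x $ k \<le> - c)"

definition cond_A3_plus ::
  "'d::finite \<Rightarrow> (real \<Rightarrow> real ^ 'd \<Rightarrow> real ^ 'd) \<Rightarrow> (real \<Rightarrow> real ^ 'd \<Rightarrow> real ^ 'd)
    \<Rightarrow> real ^ 'd \<Rightarrow> real \<Rightarrow> real \<Rightarrow> real \<Rightarrow> bool" where
  "cond_A3_plus k bp bm x0 T \<delta> c \<longleftrightarrow>
     (\<forall>t\<in>{0..T}.
        (\<forall>x. x $ k > 0 \<and> norm (x - x0) \<le> \<delta> \<longrightarrow> bp t x $ k \<le> - c) \<and>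
        (\<forall>x. x \<in> hyperplane k \<and> norm (x - x0) \<le> \<delta> \<longrightarrow> bm t x $ k = 0))"

definition cond_A3_minus ::
  "'d::finite \<Rightarrow> (real \<Rightarrow> real ^ 'd \<Rightarrow> real ^ 'd) \<Rightarrow> (real \<Rightarrow> real ^ 'd \<Rightarrow> real ^ 'd)
    \<Rightarrow> real ^ 'd \<Rightarrow> real \<Rightarrow> real \<Rightarrow> real \<Rightarrow> bool" where
  "cond_A3_minus k bp bm x0 T \<delta> c \<longleftrightarrow>
     (\<forall>t\<in>{0..T}.
        (\<forall>x. x $ k < 0 \<and> norm (x - x0) \<le> \<delta> \<longrightarrow> bm t x $ k \<ge> c) \<and>
        (\<forall>x. x \<in> hyperplane k \<and> norm (x - x0) \<le> \<delta> \<longrightarrow> bp t x $ k = 0))"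


subsection \<open>The limit equation on the hyperplane\<close>

text \<open>In the following definitions a point \<open>v\<close> of the hyperplane stands for both the
  \<open>(d - 1)\<close>-dimensional argument and the point \<open>(v, 0)\<close>.\<close>

definition p_plus ::
  "'d::finite \<Rightarrow> (real \<Rightarrow> real ^ 'd \<Rightarrow> real ^ 'd) \<Rightarrow> (real \<Rightarrow> real ^ 'd \<Rightarrow> real ^ 'd)
    \<Rightarrow> real \<Rightarrow> real ^ 'd \<Rightarrow> real" where
  "p_plus k bp bm s v = \<bar>bp s v $ k\<bar> / (\<bar>bm s v $ k\<bar> + \<bar>bp s v $ k\<bar>)"

definition p_minus ::
  "'d::finite \<Rightarrow> (real \<Rightarrow> real ^ 'd \<Rightarrow> real ^ 'd) \<Rightarrow> (real \<Rightarrow> real ^ 'd \<Rightarrow> real ^ 'd)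
    \<Rightarrow> real \<Rightarrow> real ^ 'd \<Rightarrow> real" where
  "p_minus k bp bm s v = \<bar>bm s v $ k\<bar> / (\<bar>bm s v $ k\<bar> + \<bar>bp s v $ k\<bar>)"

definition limit_drift ::
  "'d::finite \<Rightarrow> (real \<Rightarrow> real ^ 'd \<Rightarrow> real ^ 'd) \<Rightarrow> (real \<Rightarrow> real ^ 'd \<Rightarrow> real ^ 'd)
    \<Rightarrow> real \<Rightarrow> real ^ 'd \<Rightarrow> real ^ 'd" where
  "limit_drift k bp bm s v =
     p_minus k bp bm s v *\<^sub>R bar k (bp s v) + p_plus k bp bm s v *\<^sub>R bar k (bm s v)"

text \<open>Infimum in the extended reals: the exit time is \<open>\<infinity>\<close> if the path never exits.\<close>

definition exit_time :: "real \<Rightarrow> real ^ 'd \<Rightarrow> (real \<Rightarrow> real ^ 'd::finite) \<Rightarrow> ereal" where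
  "exit_time \<delta> x0 f = Inf (ereal ` {t. t \<ge> 0 \<and> norm (f t - x0) \<ge> \<delta>})"

text \<open>The horizon \<open>\<sigma>\<^sub>\<delta>(f) \<and> T\<close>; it is finite, so passing back to the reals loses nothing.\<close>

definition stop_time :: "real \<Rightarrow> real ^ 'd \<Rightarrow> (real \<Rightarrow> real ^ 'd::finite) \<Rightarrow> real \<Rightarrow> real" where
  "stop_time \<delta> x0 f T = real_of_ereal (min (exit_time \<delta> x0 f) (ereal T))"

text \<open>Membership in the hyperplane is the statement \<open>X\<^sup>0 = (bar X\<^sup>0, 0)\<close>. Continuity on the interval
  is a consequence of the integral equation.\<close>

definition limit_solution ::
  "'d::finite \<Rightarrow> (real \<Rightarrow> real ^ 'd \<Rightarrow> real ^ 'd) \<Rightarrow> (real \<Rightarrow> real ^ 'd \<Rightarrow> real ^ 'd)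
    \<Rightarrow> real ^ 'd \<Rightarrow> real \<Rightarrow> (real \<Rightarrow> real ^ 'd) \<Rightarrow> bool" where
  "limit_solution k bp bm x0 \<tau> X0 \<longleftrightarrow>
     (\<forall>t\<in>{0..\<tau>}.
        X0 t \<in> hyperplane k \<and>
        set_integrable lborel {0..t} (\<lambda>s. limit_drift k bp bm s (X0 s)) \<and>
        X0 t = x0 + (LINT s:{0..t}|lborel. limit_drift k bp bm s (X0 s)))"


subsection \<open>Wiener process and strong solutions\<close>

definition wiener_process :: "'w measure \<Rightarrow> (real \<Rightarrow> 'w \<Rightarrow> real ^ 'd::finite) \<Rightarrow> bool" where
  "wiener_process M w \<longleftrightarrow>
     prob_space M \<and>
     (\<forall>t\<ge>0. w t \<in> borel_measurable M) \<and>
     (AE \<omega> in M. w 0 \<omega> = 0) \<and>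
     (AE \<omega> in M. continuous_on {0..} (\<lambda>t. w t \<omega>)) \<and>
     (\<forall>(n::nat) (t :: nat \<Rightarrow> real). 0 \<le> t 0 \<and> (\<forall>i<n. t i \<le> t (Suc i)) \<longrightarrow>
        prob_space.indep_vars M (\<lambda>_. borel) (\<lambda>i \<omega>. w (t (Suc i)) \<omega> - w (t i) \<omega>) {..<n}) \<and>
     (\<forall>s t. 0 \<le> s \<and> s < t \<longrightarrow>
        distributed M lborel (\<lambda>\<omega>. w t \<omega> - w s \<omega>)
          (\<lambda>x. ennreal (\<Prod>i\<in>UNIV. normal_density 0 (sqrt (t - s)) (x $ i))))"

text \<open>The filtration generated by \<open>w\<close>, augmented by the null sets of \<open>M\<close>.\<close>

definition augmented_filtration ::
  "'w measure \<Rightarrow> (real \<Rightarrow> 'w \<Rightarrow> real ^ 'd::finite) \<Rightarrow> real \<Rightarrow> 'w measure" where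
  "augmented_filtration M w t =
     sigma (space M)
       ({w s -` A \<inter> space M | s A. 0 \<le> s \<and> s \<le> t \<and> A \<in> sets borel} \<union> null_sets M)"

text \<open>A random element of \<open>C([0,\<infinity>), \<real>\<^sup>d)\<close>, given as a process with continuous paths.\<close>

definition random_path :: "'w measure \<Rightarrow> (real \<Rightarrow> 'w \<Rightarrow> real ^ 'd::finite) \<Rightarrow> bool" where
  "random_path M Z \<longleftrightarrow>
     (\<forall>t\<ge>0. Z t \<in> borel_measurable M) \<and>
     (\<forall>\<omega>\<in>space M. continuous_on {0..} (\<lambda>t. Z t \<omega>))"

definition strong_solution ::
  "'w measure \<Rightarrow> (real \<Rightarrow> 'w \<Rightarrow> real ^ 'd) \<Rightarrow> (real \<Rightarrow> real ^ 'd \<Rightarrow> real ^ 'd)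
    \<Rightarrow> real ^ 'd \<Rightarrow> real \<Rightarrow> (real \<Rightarrow> 'w \<Rightarrow> real ^ 'd::finite) \<Rightarrow> bool" where
  "strong_solution M w b x0 \<epsilon> X \<longleftrightarrow>
     random_path M X \<and>
     (\<forall>t\<ge>0. X t \<in> borel_measurable (augmented_filtration M w t)) \<and>
     (AE \<omega> in M. \<forall>t\<ge>0.
        set_integrable lborel {0..t} (\<lambda>s. b s (X s \<omega>)) \<and>
        X t \<omega> = x0 + (LINT s:{0..t}|lborel. b s (X s \<omega>)) + \<epsilon> *\<^sub>R w t \<omega>)"

text \<open>
  Convergence in probability in \<open>C([0,\<infinity>), \<real>\<^sup>d)\<close> with the topology of uniform convergence on
  compact sets: the sets \<open>{(f, g). \<forall>t\<in>K. dist (f t) (g t) \<le> \<eta>}\<close>, for \<open>K\<close> compact and \<open>\<eta> > 0\<close>,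
  form a base of the uniformity of this space. The events below are measurable because
  the paths are continuous.
\<close>

definition converges_in_probability_C ::
  "'w measure \<Rightarrow> ('e \<Rightarrow> real \<Rightarrow> 'w \<Rightarrow> real ^ 'd) \<Rightarrow> (real \<Rightarrow> 'w \<Rightarrow> real ^ 'd::finite)
    \<Rightarrow> 'e filter \<Rightarrow> bool" where
  "converges_in_probability_C M Z Y F \<longleftrightarrow>
     (\<forall>\<^sub>F \<epsilon> in F. random_path M (Z \<epsilon>)) \<and> random_path M Y \<and>
     (\<forall>K \<eta>. compact K \<and> K \<subseteq> {0..} \<and> \<eta> > 0 \<longrightarrow>
        ((\<lambda>\<epsilon>. measure M {\<omega> \<in> space M. \<exists>t\<in>K. dist (Z \<epsilon> t \<omega>) (Y t \<omega>) > \<eta>}) \<longlongrightarrow> 0) F)"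

end

theory Submission
  imports Defs
begin

text \<open>The convergence is pathwise: if \<open>x(t) = x\<^sup>0 + \<integral> b(s, x(s)) ds + g(t)\<close> with \<open>\<bar>g\<bar> \<le> r\<close>, then \<open>x\<close>
  is close to \<open>X\<^sup>0\<close>, with a bound depending on \<open>r\<close> only. All three conditions give
  \<open>b\<^sub>d\<^sup>+ \<le> 0 \<le> b\<^sub>d\<^sup>-\<close> and \<open>b\<^sub>d\<^sup>- - b\<^sub>d\<^sup>+ \<ge> c\<close> on the hyperplane near \<open>x\<^sup>0\<close>. With the Lipschitz
  condition the normal drift is inward up to \<open>L \<bar>x\<^sub>d\<bar>\<close>, so \<open>x\<^sub>d = O(r)\<close>, and therefore the integral
  of the normal drift is \<open>O(r)\<close> too. Up to an error \<open>O(\<bar>x - X\<^sup>0\<bar>)\<close>, the drift equals the sliding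
  velocity minus \<open>b\<^sub>d(s, x(s)) \<gamma>(s)\<close>, where \<open>\<gamma> = (b\<^sup>+ - b\<^sup>-) / (b\<^sub>d\<^sup>- - b\<^sub>d\<^sup>+)\<close> along \<open>X\<^sup>0\<close>
  is continuous and does not depend on \<open>x\<close>; the last term thus integrates to something small, and
  Gronwall's inequality concludes.

  The conditions are available only inside the \<open>\<delta>\<close>-ball, so this runs up to a time slightly before
  the exit of \<open>X\<^sup>0\<close>; the remaining short interval contributes little by boundedness of the drift.\<close>

section \<open>Analytic tools: Gronwall's inequality, averaging, inward drift in dimension
  one\<close>

lemma gronwall:
  fixes u :: "real \<Rightarrow> real"
  assumes u: "continuous_on {a..b} u" and K: "K \<ge> 0"
    and le: "\<And>t. t \<in> {a..b} \<Longrightarrow> u t \<le> A + K * integral {a..t} u"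
    and t: "t \<in> {a..b}"
  shows "u t \<le> A * exp (K * (t - a))"
proof -
  define V where "V s = A + K * integral {a..s} u" for s
  have V': "(V has_real_derivative K * u s) (at s)" if "a < s" "s < b" for s
  proof -
    have "((\<lambda>s. integral {a..s} u) has_real_derivative u s) (at s within {a..b})"
      using integral_has_real_derivative[OF u, of s] that by simp
    moreover have "at s within {a..b} = at s"
      using that by (intro at_within_interior) (auto simp: interior_atLeastAtMost_real)
    ultimately show ?thesis unfolding V_def by (auto intro!: derivative_eq_intros)
  qed
  \<comment> \<open>Since V' = K u <= K V inside the interval, the discounted right-hand side is
    nonincreasing.\<close>
  have "V t * exp (- K * (t - a)) \<le> V a * exp (- K * (a - a))"
  proof (rule DERIV_nonpos_imp_decreasing_open[where f = "\<lambda>s. V s * exp (- K * (s - a))"])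
    show "a \<le> t" using t by simp
    show "continuous_on {a..t} (\<lambda>s. V s * exp (- K * (s - a)))" unfolding V_def
      using continuous_on_subset[OF indefinite_integral_continuous_1[OF integrable_continuous_real[OF u]], of "{a..t}"] t
      by (intro continuous_intros) auto
    fix s assume s: "a < s" "s < t"
    have "((\<lambda>s. V s * exp (- K * (s - a))) has_real_derivative
        (K * (u s - V s)) * exp (- K * (s - a))) (at s)"
      using s t by (auto intro!: derivative_eq_intros V' simp: algebra_simps)
    moreover have "(K * (u s - V s)) * exp (- K * (s - a)) \<le> 0"
      using le[of s] s t K by (intro mult_nonpos_nonneg mult_nonneg_nonpos) (auto simp: V_def)
    ultimately show "\<exists>y. ((\<lambda>s. V s * exp (- K * (s - a))) has_real_derivative y) (at s) \<and> y \<le> 0"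
      by blast
  qed
  then have "V t * exp (- K * (t - a)) \<le> A" by (simp add: V_def)
  then have "V t * exp (- K * (t - a)) * exp (K * (t - a)) \<le> A * exp (K * (t - a))"
    by (intro mult_right_mono) auto
  then have "V t \<le> A * exp (K * (t - a))"
    by (simp add: mult.assoc flip: exp_add)
  then show ?thesis using le[OF t] by (simp add: V_def)
qed

text \<open>On a short piece \<open>\<gamma>\<close> is nearly constant; freezing it at the left end
  leaves an increment of the integral of \<open>h\<close>, which is small. As \<open>\<rho>\<close>
  is chosen before \<open>h\<close> and \<open>t\<close>, the bound can be applied along a path that
  is not known in advance.\<close>

lemma integral_scaleR_small:
  fixes \<gamma> :: "real \<Rightarrow> 'a::euclidean_space"
  assumes \<gamma>: "continuous_on {0..S} \<gamma>" and S: "S \<ge> 0" and B: "B \<ge> 0" and \<beta>: "\<beta> > 0"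
  obtains \<rho> where "\<rho> > 0"
    "\<And>h t. t \<in> {0..S} \<Longrightarrow> h integrable_on {0..t} \<Longrightarrow> (\<lambda>s. h s *\<^sub>R \<gamma> s) integrable_on {0..t} \<Longrightarrow>
       (\<And>s. s \<in> {0..t} \<Longrightarrow> \<bar>h s\<bar> \<le> B) \<Longrightarrow> (\<And>s. s \<in> {0..t} \<Longrightarrow> \<bar>integral {0..s} h\<bar> \<le> \<rho>) \<Longrightarrow>
       norm (integral {0..t} (\<lambda>s. h s *\<^sub>R \<gamma> s)) \<le> \<beta>"
proof -
  \<comment> \<open>Freezing \<open>\<gamma>\<close> up to \<open>\<beta>'\<close> costs at most
    \<open>B * \<beta>' * S\<close>, which is to be at most half of \<open>\<beta>\<close>; the
    \<open>+ 1\<close> covers \<open>B * S = 0\<close>.\<close>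
  define \<beta>' where "\<beta>' = \<beta> / (2 * (B * S + 1))"
  have BS: "B * S + 1 > 0" using B S by (simp add: add_nonneg_pos)
  have \<beta>': "\<beta>' > 0" using \<beta> BS by (simp add: \<beta>'_def)
  have \<beta>'2: "B * \<beta>' * S \<le> \<beta> / 2"
  proof -
    have "B * \<beta>' * S = (\<beta> / 2) * ((B * S) / (B * S + 1))" by (simp add: \<beta>'_def)
    also have "\<dots> \<le> (\<beta> / 2) * 1" using \<beta> BS by (intro mult_left_mono) auto
    finally show ?thesis by simp
  qed
  have "uniformly_continuous_on {0..S} \<gamma>"
    using \<gamma> by (intro compact_uniformly_continuous) auto
  then obtain d where d: "d > 0"
    and dd: "\<And>s s'. s \<in> {0..S} \<Longrightarrow> s' \<in> {0..S} \<Longrightarrow> dist s' s < d \<Longrightarrow> dist (\<gamma> s') (\<gamma> s) < \<beta>'"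
    using \<beta>' unfolding uniformly_continuous_on_def by metis
  have "bounded (\<gamma> ` {0..S})"
    using \<gamma> by (intro compact_imp_bounded compact_continuous_image) auto
  then obtain \<Gamma> where \<Gamma>: "\<Gamma> > 0" "\<And>s. s \<in> {0..S} \<Longrightarrow> norm (\<gamma> s) \<le> \<Gamma>"
    unfolding bounded_pos by auto
  \<comment> \<open>\<open>N\<close> pieces of length \<open>d / 2\<close>, strictly below the
    modulus of continuity \<open>d\<close>, cover \<open>{0..S}\<close>.\<close>
  obtain N where N: "S < real N * (d / 2)" using d reals_Archimedean3[of "d/2"] by auto
  have N0: "N > 0" using N S by (cases N) auto
  \<comment> \<open>Each piece adds at most \<open>2 * \<Gamma> * \<rho>\<close>, since an increment
    of the integral of \<open>h\<close> is a difference of two values bounded by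
    \<open>\<rho>\<close>; all \<open>N\<close> pieces give \<open>\<beta> / 2\<close>.\<close>
  define \<rho> where "\<rho> = \<beta> / (4 * \<Gamma> * real N)"
  have \<rho>: "\<rho> > 0" using \<beta> \<Gamma> N0 by (simp add: \<rho>_def)
  show ?thesis
  proof (rule that[OF \<rho>])
    fix h t
    assume t: "t \<in> {0..S}" and h: "h integrable_on {0..t}" "(\<lambda>s. h s *\<^sub>R \<gamma> s) integrable_on {0..t}"
      and hB: "\<And>s. s \<in> {0..t} \<Longrightarrow> \<bar>h s\<bar> \<le> B"
      and H: "\<And>s. s \<in> {0..t} \<Longrightarrow> \<bar>integral {0..s} h\<bar> \<le> \<rho>"
    have "norm (integral {0..s} (\<lambda>s. h s *\<^sub>R \<gamma> s)) \<le> B * \<beta>' * s + real n * (2 * \<Gamma> * \<rho>)"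
      if "s \<in> {0..t}" "s \<le> real n * (d / 2)" for s n
      using that
    proof (induction n arbitrary: s)
      case 0
      then show ?case by simp
    next
      case (Suc n)
      show ?case
      proof (cases "s \<le> real n * (d / 2)")
        case True
        from Suc.IH[OF Suc.prems(1) True] show ?thesis
          using mult_pos_pos[OF \<Gamma>(1) \<rho>] by (simp add: algebra_simps)
      next
        case False
        define q where "q = real n * (d / 2)"
        have q: "0 \<le> q" "q \<le> s" "s - q < d"
          using False Suc.prems d by (auto simp: q_def algebra_simps)
        have i1: "(\<lambda>s. h s *\<^sub>R \<gamma> s) integrable_on {0..s}" "h integrable_on {0..s}"
          using h Suc.prems by (auto intro: integrable_on_subinterval)
        then have i2: "(\<lambda>s. h s *\<^sub>R \<gamma> s) integrable_on {q..s}" "h integrable_on {q..s}"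
          using q by (auto intro: integrable_on_subinterval)
        have i3: "(\<lambda>u. h u *\<^sub>R \<gamma> q) integrable_on {q..s}"
          using i2(2) by (rule integrable_on_scaleR_left)
        have e1: "integral {0..s} (\<lambda>s. h s *\<^sub>R \<gamma> s) =
            integral {0..q} (\<lambda>s. h s *\<^sub>R \<gamma> s) + integral {q..s} (\<lambda>s. h s *\<^sub>R \<gamma> s)"
          using Henstock_Kurzweil_Integration.integral_combine[OF q(1,2) i1(1)] by simp
        have e2: "integral {q..s} (\<lambda>s. h s *\<^sub>R \<gamma> s) =
            integral {q..s} (\<lambda>u. h u *\<^sub>R (\<gamma> u - \<gamma> q)) + integral {q..s} h *\<^sub>R \<gamma> q"
          using Henstock_Kurzweil_Integration.integral_diff[OF i2(1) i3] integral_unique[OF has_integral_scaleR_left[OF integrable_integral[OF i2(2)], of "\<gamma> q"]]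
          by (simp add: scaleR_diff_right)
        have e3: "integral {q..s} h = integral {0..s} h - integral {0..q} h"
          using Henstock_Kurzweil_Integration.integral_combine[OF q(1,2) i1(2)] by simp
        have b1: "norm (integral {q..s} (\<lambda>u. h u *\<^sub>R (\<gamma> u - \<gamma> q))) \<le> integral {q..s} (\<lambda>u. B * \<beta>')"
        proof (rule integral_norm_bound_integral)
          show "(\<lambda>u. h u *\<^sub>R (\<gamma> u - \<gamma> q)) integrable_on {q..s}"
            using Henstock_Kurzweil_Integration.integrable_diff[OF i2(1) i3]
            by (simp add: scaleR_diff_right)
          fix u assume u: "u \<in> {q..s}"
          have "dist (\<gamma> u) (\<gamma> q) < \<beta>'"
            using u q Suc.prems t by (intro dd) (auto simp: dist_real_def)
          then show "norm (h u *\<^sub>R (\<gamma> u - \<gamma> q)) \<le> B * \<beta>'"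
            using hB[of u] u q Suc.prems B by (auto simp: dist_norm intro!: mult_mono)
        qed auto
        also have "\<dots> = B * \<beta>' * (s - q)" using q by simp
        finally have b1: "norm (integral {q..s} (\<lambda>u. h u *\<^sub>R (\<gamma> u - \<gamma> q))) \<le> B * \<beta>' * (s - q)" .
        have b2: "norm (integral {q..s} h *\<^sub>R \<gamma> q) \<le> (2 * \<rho>) * \<Gamma>"
          using H[of s] H[of q] q Suc.prems \<Gamma>(2)[of q] t \<rho>
          by (auto simp: e3 intro!: mult_mono)
        have b3: "norm (integral {0..q} (\<lambda>s. h s *\<^sub>R \<gamma> s)) \<le> B * \<beta>' * q + real n * (2 * \<Gamma> * \<rho>)"
          using q Suc.prems by (intro Suc.IH) (auto simp: q_def)
        have "norm (integral {0..s} (\<lambda>s. h s *\<^sub>R \<gamma> s)) \<le>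
            (B * \<beta>' * q + real n * (2 * \<Gamma> * \<rho>)) + (B * \<beta>' * (s - q) + (2 * \<rho>) * \<Gamma>)"
          unfolding e1 e2 by (intro norm_triangle_mono b1 b2 b3)
        then show ?thesis by (simp add: algebra_simps)
      qed
    qed
    from this[of t N] have "norm (integral {0..t} (\<lambda>s. h s *\<^sub>R \<gamma> s)) \<le> B * \<beta>' * t + real N * (2 * \<Gamma> * \<rho>)"
      using t N by auto
    also have "real N * (2 * \<Gamma> * \<rho>) = \<beta> / 2" using N0 \<Gamma> by (simp add: \<rho>_def)
    also have "B * \<beta>' * t \<le> B * \<beta>' * S" using t B \<beta>' by (intro mult_left_mono) auto
    finally show "norm (integral {0..t} (\<lambda>s. h s *\<^sub>R \<gamma> s)) \<le> \<beta>" using \<beta>'2 by simp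
  qed
qed

text \<open>Compare with the last time before \<open>t\<close> at which \<open>y \<le> r\<close>.\<close>

lemma upper_bound_if_drift_inward:
  fixes y f g :: "real \<Rightarrow> real"
  assumes y: "continuous_on {0..t} y" and f: "f integrable_on {0..t}" and t: "0 \<le> t"
    and eq: "\<And>s. s \<in> {0..t} \<Longrightarrow> y s = integral {0..s} f + g s"
    and g: "\<And>s. s \<in> {0..t} \<Longrightarrow> \<bar>g s\<bar> \<le> r"
    and L: "L \<ge> 0"
    and inward: "\<And>s. s \<in> {0..t} \<Longrightarrow> y s > 0 \<Longrightarrow> f s \<le> L * \<bar>y s\<bar>"
  shows "y t \<le> 3 * r + L * integral {0..t} (\<lambda>s. \<bar>y s\<bar>)"
proof -
  have r: "r \<ge> 0" using g[of 0] t by auto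
  have iy: "(\<lambda>s. \<bar>y s\<bar>) integrable_on {0..t}"
    using y by (intro integrable_continuous_real continuous_intros)
  define Z where "Z = {s \<in> {0..t}. y s \<le> r}"
  have "closed Z"
    unfolding Z_def using continuous_closed_preimage[OF y, of "{..r}"]
    by (auto simp: vimage_def Int_def)
  moreover have "bounded Z" unfolding Z_def by (rule bounded_subset[OF bounded_closed_interval[of 0 t]]) auto
  ultimately have "compact Z" by (simp add: compact_eq_bounded_closed)
  moreover have "0 \<in> Z" using eq[of 0] g[of 0] t by (auto simp: Z_def)
  ultimately obtain s where s: "s \<in> Z" and smax: "\<And>s'. s' \<in> Z \<Longrightarrow> s' \<le> s"
    using compact_attains_sup[of Z] by blast
  have st: "0 \<le> s" "s \<le> t" "y s \<le> r" using s by (auto simp: Z_def)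
  \<comment> \<open>After the last visit to \<open>Z\<close> the path exceeds
    \<open>r \<ge> 0\<close>, so the inward condition is available.\<close>
  have pos: "y u > 0" if "u \<in> {s..t} - {s}" for u
    using smax[of u] that st r by (force simp: Z_def)
  have if': "f integrable_on {s..t}" and iy': "(\<lambda>s. \<bar>y s\<bar>) integrable_on {s..t}"
    using f iy st by (auto intro: integrable_on_subinterval)
  \<comment> \<open>At \<open>s\<close> itself \<open>y\<close> need not be positive, so
    \<open>f\<close> is changed at this single point.\<close>
  define f' where "f' u = (if u = s then 0 else f u)" for u
  have "integral {s..t} f = integral {s..t} f'"
    by (rule integral_spike[of "{s}"]) (auto simp: f'_def)
  also have "\<dots> \<le> integral {s..t} (\<lambda>s. L * \<bar>y s\<bar>)"
  proof (rule integral_le)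
    show "f' integrable_on {s..t}"
      by (rule integrable_spike[OF if', of "{s}"]) (auto simp: f'_def)
    show "f' u \<le> L * \<bar>y u\<bar>" if "u \<in> {s..t}" for u
      using inward[of u] pos[of u] that st L by (auto simp: f'_def)
  qed (use integrable_on_cmult_left[OF iy', of L] in auto)
  also have "\<dots> = L * integral {s..t} (\<lambda>s. \<bar>y s\<bar>)" by simp
  also have "\<dots> \<le> L * integral {0..t} (\<lambda>s. \<bar>y s\<bar>)"
    using st L iy iy' by (intro mult_left_mono integral_subset_le) auto
  finally have "integral {s..t} f \<le> L * integral {0..t} (\<lambda>s. \<bar>y s\<bar>)" .
  moreover have "integral {0..t} f = integral {0..s} f + integral {s..t} f"
    using Henstock_Kurzweil_Integration.integral_combine[OF st(1,2) f] by simp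
  \<comment> \<open>The \<open>3 * r\<close> is made of \<open>y s \<le> r\<close> and the increment
    \<open>g t - g s \<le> 2 * r\<close>.\<close>
  ultimately show ?thesis using eq[of s] eq[of t] g[of s] g[of t] st by auto
qed

text \<open>The hypotheses are symmetric under \<open>y \<mapsto> - y\<close>, so the one-sided
  bound applies to both signs and Gronwall closes the resulting inequality for
  \<open>\<bar>y\<bar>\<close>.\<close>

lemma abs_bound_if_drift_inward:
  fixes y f g :: "real \<Rightarrow> real"
  assumes y: "continuous_on {0..b} y" and f: "f integrable_on {0..b}"
    and eq: "\<And>s. s \<in> {0..b} \<Longrightarrow> y s = integral {0..s} f + g s"
    and g: "\<And>s. s \<in> {0..b} \<Longrightarrow> \<bar>g s\<bar> \<le> r"
    and L: "L \<ge> 0"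
    and inward: "\<And>s. s \<in> {0..b} \<Longrightarrow> sgn (y s) * f s \<le> L * \<bar>y s\<bar>"
    and t: "t \<in> {0..b}"
  shows "\<bar>y t\<bar> \<le> 3 * r * exp (L * t)"
proof -
  have "\<bar>y s\<bar> \<le> 3 * r + L * integral {0..s} (\<lambda>s. \<bar>y s\<bar>)" if s: "s \<in> {0..b}" for s
  proof -
    have y': "continuous_on {0..s} y" and f': "f integrable_on {0..s}"
      using y f s by (auto intro: continuous_on_subset integrable_on_subinterval)
    have "y s \<le> 3 * r + L * integral {0..s} (\<lambda>s. \<bar>y s\<bar>)"
    proof (rule upper_bound_if_drift_inward[OF y' f' _ _ _ L])
      show "f u \<le> L * \<bar>y u\<bar>" if "u \<in> {0..s}" "y u > 0" for u
        using inward[of u] that s by auto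
    qed (use s eq g in auto)
    moreover have "- y s \<le> 3 * r + L * integral {0..s} (\<lambda>s. \<bar>- y s\<bar>)"
    proof (rule upper_bound_if_drift_inward[where f = "\<lambda>s. - f s" and g = "\<lambda>s. - g s"])
      show "- f u \<le> L * \<bar>- y u\<bar>" if "u \<in> {0..s}" "- y u > 0" for u
        using inward[of u] that s by auto
    qed (use s eq g L y' f' in \<open>auto intro!: continuous_intros integrable_neg\<close>)
    ultimately show ?thesis by auto
  qed
  from gronwall[OF _ L this t] show ?thesis using y by (auto intro!: continuous_intros)
qed

section \<open>The deterministic setting near the hyperplane\<close>

lemma norm_bar_le: "norm (bar k x) \<le> norm x"
  by (rule norm_le_componentwise_cart) (auto simp: bar_def)

lemma norm_diff_bar: "norm (x - bar k x) = \<bar>x $ k\<bar>"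
proof -
  have "x - bar k x = (x $ k) *\<^sub>R axis k 1" by (auto simp: vec_eq_iff bar_def axis_def)
  then show ?thesis by simp
qed

text \<open>\<open>inward\<close> is what the three alternative conditions have in common.
  \<open>inside\<close> omits the time \<open>\<tau>\<close>, when \<open>X0\<close> may already be
  on the boundary of the ball.\<close>

locale sliding =
  fixes k :: "'d::finite"
    and bp bm :: "real \<Rightarrow> real ^ 'd \<Rightarrow> real ^ 'd"
    and x0 :: "real ^ 'd"
    and \<delta> c L \<tau> :: real
    and X0 :: "real \<Rightarrow> real ^ 'd"
  assumes cont_p: "continuous_on ({0..} \<times> UNIV) (\<lambda>(t, x). bp t x)"
    and cont_m: "continuous_on ({0..} \<times> UNIV) (\<lambda>(t, x). bm t x)"
    and lip_p: "\<And>t x y. t \<ge> 0 \<Longrightarrow> norm (bp t x - bp t y) \<le> L * norm (x - y)"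
    and lip_m: "\<And>t x y. t \<ge> 0 \<Longrightarrow> norm (bm t x - bm t y) \<le> L * norm (x - y)"
    and L: "L \<ge> 0" and c: "c > 0" and \<delta>: "\<delta> > 0" and \<tau>: "\<tau> \<ge> 0"
    and x0: "x0 $ k = 0"
    and inward: "\<And>t v. t \<in> {0..\<tau>} \<Longrightarrow> v $ k = 0 \<Longrightarrow> norm (v - x0) < \<delta> \<Longrightarrow>
      bp t v $ k \<le> 0 \<and> 0 \<le> bm t v $ k \<and> c \<le> bm t v $ k - bp t v $ k"
    and sol: "limit_solution k bp bm x0 \<tau> X0"
    and inside: "\<And>t. t \<in> {0..<\<tau>} \<Longrightarrow> norm (X0 t - x0) < \<delta>"
begin

abbreviation b where "b \<equiv> glued_drift k bp bm"

abbreviation F where "F s \<equiv> limit_drift k bp bm s (X0 s)"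

text \<open>The jump of the drift is normalised so that its \<open>k\<close>-th component is -1
  wherever the denominator is nonzero; adding \<open>(Y $ k) *\<^sub>R \<gamma> s\<close> to a
  vector \<open>Y\<close> then cancels its normal component.\<close>

definition \<gamma> where
  "\<gamma> s = inverse (bm s (X0 s) $ k - bp s (X0 s) $ k) *\<^sub>R (bp s (X0 s) - bm s (X0 s))"

text \<open>A path of the stochastic equation is the case
  \<open>g t = \<epsilon> *\<^sub>R w t \<omega>\<close>. Lebesgue integrability is recorded because
  it is inherited by products with bounded measurable functions.\<close>

definition perturbed_solution ::
  "real \<Rightarrow> (real \<Rightarrow> real ^ 'd) \<Rightarrow> (real \<Rightarrow> real ^ 'd) \<Rightarrow> bool" where
  "perturbed_solution r g x \<longleftrightarrow> continuous_on {0..\<tau>} x \<and>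
     (\<forall>t\<in>{0..\<tau>}. set_integrable lborel {0..t} (\<lambda>s. b s (x s)) \<and>
        x t = x0 + (LINT s:{0..t}|lborel. b s (x s)) + g t \<and> norm (g t) \<le> r)"

lemma X0_eq:
  assumes "t \<in> {0..\<tau>}"
  shows "F integrable_on {0..t}" "X0 t = x0 + integral {0..t} F" "X0 t $ k = 0"
proof -
  have *: "X0 t \<in> hyperplane k" "set_integrable lborel {0..t} F"
      "X0 t = x0 + (LINT s:{0..t}|lborel. F s)"
    using sol assms unfolding limit_solution_def by blast+
  show "F integrable_on {0..t}" "X0 t = x0 + integral {0..t} F"
    using set_borel_integral_eq_integral[OF *(2)] *(3) by auto
  show "X0 t $ k = 0" using *(1) by (simp add: hyperplane_def)
qed

lemma X0_continuous: "continuous_on {0..\<tau>} X0"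
proof -
  have "continuous_on {0..\<tau>} (\<lambda>t. x0 + integral {0..t} F)"
    using X0_eq(1)[of \<tau>] \<tau> by (intro continuous_intros indefinite_integral_continuous_1) auto
  then show ?thesis
    by (rule continuous_on_eq) (use X0_eq(2) in auto)
qed

lemma continuous_along_X0:
  "continuous_on {0..\<tau>} (\<lambda>s. bp s (X0 s))" "continuous_on {0..\<tau>} (\<lambda>s. bm s (X0 s))"
proof -
  have g: "continuous_on {0..\<tau>} (\<lambda>s. (s, X0 s))"
    by (intro continuous_intros X0_continuous)
  show "continuous_on {0..\<tau>} (\<lambda>s. bp s (X0 s))" "continuous_on {0..\<tau>} (\<lambda>s. bm s (X0 s))"
    using continuous_on_compose2[OF cont_p g] continuous_on_compose2[OF cont_m g]
    by (simp_all add: image_subset_iff)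
qed

text \<open>The denominator is at least \<open>c\<close> while \<open>X0\<close> is in the open
  ball; hence a horizon \<open>S\<close> on which this is known.\<close>

lemma gamma_continuous:
  assumes S: "S \<in> {0..\<tau>}" "\<And>t. t \<in> {0..S} \<Longrightarrow> norm (X0 t - x0) < \<delta>"
  shows "continuous_on {0..S} \<gamma>"
proof -
  have *: "continuous_on {0..S} (\<lambda>s. bp s (X0 s))" "continuous_on {0..S} (\<lambda>s. bm s (X0 s))"
    using continuous_along_X0 S by (auto intro: continuous_on_subset)
  have "bm s (X0 s) $ k - bp s (X0 s) $ k \<noteq> 0" if "s \<in> {0..S}" for s
    using inward[of s "X0 s"] X0_eq(3)[of s] assms(2)[of s] that S c by simp
  then show ?thesis unfolding \<gamma>_def using *
    by (intro continuous_on_scaleR continuous_on_inverse continuous_on_diff continuous_on_component) auto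
qed

lemma bounded_along_X0:
  obtains B where "B > 0" "\<And>t. t \<in> {0..\<tau>} \<Longrightarrow> norm (bp t (X0 t)) \<le> B"
    "\<And>t. t \<in> {0..\<tau>} \<Longrightarrow> norm (bm t (X0 t)) \<le> B"
proof -
  have "bounded ((\<lambda>s. bp s (X0 s)) ` {0..\<tau>})" "bounded ((\<lambda>s. bm s (X0 s)) ` {0..\<tau>})"
    by (auto intro!: compact_imp_bounded compact_continuous_image continuous_along_X0)
  then obtain B1 B2 where "B1 > 0" "\<forall>t\<in>{0..\<tau>}. norm (bp t (X0 t)) \<le> B1"
    "\<forall>t\<in>{0..\<tau>}. norm (bm t (X0 t)) \<le> B2"
    unfolding bounded_pos by auto
  then show ?thesis by (intro that[of "max B1 B2"]) (auto simp: le_max_iff_disj)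
qed

section \<open>Pointwise estimates for the discontinuous drift\<close>

text \<open>Both weights are at most 1, even if both normal components vanish, when division by zero
  makes them 0. So the bound is available up to \<open>\<tau>\<close>.\<close>

lemma norm_limit_drift_le: "norm (limit_drift k bp bm t v) \<le> norm (bp t v) + norm (bm t v)"
proof -
  have p: "\<bar>p_minus k bp bm t v\<bar> \<le> 1" "\<bar>p_plus k bp bm t v\<bar> \<le> 1"
    by (auto simp: p_minus_def p_plus_def abs_le_iff divide_le_eq_1)
  have "norm (limit_drift k bp bm t v) \<le>
      \<bar>p_minus k bp bm t v\<bar> * norm (bar k (bp t v)) + \<bar>p_plus k bp bm t v\<bar> * norm (bar k (bm t v))"
    unfolding limit_drift_def by (metis norm_scaleR norm_triangle_ineq)
  also have "\<dots> \<le> 1 * norm (bp t v) + 1 * norm (bm t v)"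
    by (intro add_mono mult_mono p norm_bar_le) auto
  finally show ?thesis by simp
qed

text \<open>The glued drift jumps, so no Lipschitz bound across the hyperplane is possible; instead
  the branch selected by \<open>y\<close> is compared with the same branch at
  \<open>v\<close>.\<close>

lemma glued_drift_near:
  assumes "t \<ge> 0"
  shows "norm (b t y - bp t v) \<le> L * norm (y - v) \<or> norm (b t y - bm t v) \<le> L * norm (y - v)"
  using lip_p[OF assms, of y v] lip_m[OF assms, of y v] by (auto simp: glued_drift_def)

text \<open>The normal component of the drift measures its deviation from the sliding velocity: both
  one-sided drifts \<open>Y\<close> satisfy \<open>Y - F + Y\<^sub>k \<gamma> = 0\<close> on the hyperplane.\<close>

lemma drift_decomposition:
  assumes t: "t \<in> {0..\<tau>}" and X: "norm (X0 t - x0) < \<delta>"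
  shows "norm (b t y - F t + (b t y $ k) *\<^sub>R \<gamma> t) \<le> (1 + norm (\<gamma> t)) * L * norm (y - X0 t)"
proof -
  define P Q where "P = bp t (X0 t)" and "Q = bm t (X0 t)"
  define D where "D = Q $ k - P $ k"
  have PQ: "P $ k \<le> 0" "0 \<le> Q $ k" "D > 0"
    using inward[OF t X0_eq(3)[OF t] X] c by (auto simp: P_def Q_def D_def)
  \<comment> \<open>The signs of the normal components remove the absolute values, and the
    denominator becomes \<open>D\<close>.\<close>
  have F: "F t = (Q $ k / D) *\<^sub>R bar k P + (- P $ k / D) *\<^sub>R bar k Q"
    using PQ by (simp add: limit_drift_def p_minus_def p_plus_def D_def flip: P_def Q_def)
  have \<gamma>: "\<gamma> t = inverse D *\<^sub>R (P - Q)" by (simp add: \<gamma>_def D_def P_def Q_def)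
  have "D \<noteq> 0" using PQ by simp
  then have zero: "Y - F t + (Y $ k) *\<^sub>R \<gamma> t = 0" if "Y = P \<or> Y = Q" for Y
    using that unfolding F \<gamma>
    by (auto simp: vec_eq_iff bar_def field_simps) (auto simp: D_def algebra_simps)
  obtain Y where Y: "Y = P \<or> Y = Q" "norm (b t y - Y) \<le> L * norm (y - X0 t)"
    using glued_drift_near[of t y "X0 t"] t by (auto simp: P_def Q_def)
  \<comment> \<open>The expression to be bounded is affine in the drift and vanishes at
    \<open>Y\<close>; only its linear part, applied to \<open>e\<close>, remains.\<close>
  define e where "e = b t y - Y"
  have "b t y - F t + (b t y $ k) *\<^sub>R \<gamma> t = (Y - F t + (Y $ k) *\<^sub>R \<gamma> t) + (e + (e $ k) *\<^sub>R \<gamma> t)"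
    by (simp add: e_def algebra_simps)
  then have "norm (b t y - F t + (b t y $ k) *\<^sub>R \<gamma> t) = norm (e + (e $ k) *\<^sub>R \<gamma> t)"
    using zero[OF Y(1)] by simp
  also have "\<dots> \<le> norm e + \<bar>e $ k\<bar> * norm (\<gamma> t)"
    by (metis norm_scaleR norm_triangle_ineq)
  also have "\<dots> \<le> norm e + norm e * norm (\<gamma> t)"
    by (intro add_left_mono mult_right_mono component_le_norm_cart) auto
  also have "\<dots> = (1 + norm (\<gamma> t)) * norm e" by (simp add: algebra_simps)
  also have "\<dots> \<le> (1 + norm (\<gamma> t)) * (L * norm (y - X0 t))"
    using Y(2) by (intro mult_left_mono) (auto simp: e_def)
  finally show ?thesis by (simp add: mult.assoc)
qed

text \<open>The projection \<open>bar k y\<close> stays in the ball because \<open>x0\<close> is on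
  the hyperplane. There the signs are known, and moving from it to \<open>y\<close> over the
  distance \<open>\<bar>y $ k\<bar>\<close> costs \<open>L * \<bar>y $ k\<bar>\<close>.\<close>

lemma drift_inward:
  assumes t: "t \<in> {0..\<tau>}" and y: "norm (y - x0) < \<delta>"
  shows "sgn (y $ k) * (b t y $ k) \<le> L * \<bar>y $ k\<bar>"
proof -
  define v where "v = bar k y"
  have v: "v $ k = 0" by (simp add: v_def bar_def)
  have "v - x0 = bar k (y - x0)" using x0 by (auto simp: v_def bar_def vec_eq_iff)
  then have "norm (v - x0) < \<delta>" using y norm_bar_le[of k "y - x0"] by simp
  note in' = inward[OF t v this]
  have n: "norm (y - v) = \<bar>y $ k\<bar>" by (simp add: v_def norm_diff_bar)
  have "\<bar>(bp t y - bp t v) $ k\<bar> \<le> L * \<bar>y $ k\<bar>" "\<bar>(bm t y - bm t v) $ k\<bar> \<le> L * \<bar>y $ k\<bar>"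
    using lip_p[of t y v] lip_m[of t y v] t n
      order_trans[OF component_le_norm_cart[of "bp t y - bp t v" k]]
      order_trans[OF component_le_norm_cart[of "bm t y - bm t v" k]] by auto
  then show ?thesis using in' L by (auto simp: glued_drift_def sgn_if)
qed

section \<open>Integral identities and integrability for perturbed solutions\<close>

lemma perturbed_solutionD:
  assumes "perturbed_solution r g x" and t: "t \<in> {0..\<tau>}"
  shows "(\<lambda>s. b s (x s)) integrable_on {0..t}"
    and "x t = x0 + integral {0..t} (\<lambda>s. b s (x s)) + g t"
    and "norm (g t) \<le> r" and "set_integrable lborel {0..t} (\<lambda>s. b s (x s))"
  using assms set_borel_integral_eq_integral[of "{0..t}" "\<lambda>s. b s (x s)"]
  by (auto simp: perturbed_solution_def)

lemma diff_X0:
  assumes p: "perturbed_solution r g x" and t: "t \<in> {0..\<tau>}"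
  shows "(\<lambda>s. b s (x s) - F s) integrable_on {0..t}"
    "x t - X0 t = integral {0..t} (\<lambda>s. b s (x s) - F s) + g t"
  using perturbed_solutionD(1,2)[OF p t] X0_eq[OF t]
  by (auto intro!: integrable_diff simp: Henstock_Kurzweil_Integration.integral_diff)

text \<open>A product of gauge integrable functions need not be integrable, so the argument goes
  through Lebesgue integrability, with the bounded factor \<open>\<gamma>\<close>.\<close>

lemma normal_drift_gamma_integrable:
  assumes p: "perturbed_solution r g x" and S: "S \<in> {0..\<tau>}" and cont: "continuous_on {0..S} \<gamma>"
  shows "(\<lambda>s. (b s (x s) $ k) *\<^sub>R \<gamma> s) integrable_on {0..S}"
proof -
  have "bounded (\<gamma> ` {0..S})"
    using cont by (intro compact_imp_bounded compact_continuous_image) auto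
  then obtain \<Gamma> where \<Gamma>: "\<Gamma> > 0" "\<forall>s\<in>{0..S}. norm (\<gamma> s) \<le> \<Gamma>"
    unfolding bounded_pos by auto
  define f where "f s = indicator {0..S} s *\<^sub>R b s (x s)" for s
  define \<gamma>' where "\<gamma>' s = indicator {0..S} s *\<^sub>R \<gamma> s" for s
  have f: "integrable lborel f"
    using perturbed_solutionD(4)[OF p S] by (simp add: set_integrable_def f_def [abs_def])
  have \<gamma>': "\<gamma>' \<in> borel_measurable lborel"
    unfolding \<gamma>'_def using borel_measurable_continuous_on_indicator[OF _ cont] by simp
  have "integrable lborel (\<lambda>s. (f s $ k) *\<^sub>R \<gamma>' s)"
  proof (rule Bochner_Integration.integrable_bound)
    show "integrable lborel (\<lambda>s. \<Gamma> * norm (f s))" using f by simp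
    show "(\<lambda>s. (f s $ k) *\<^sub>R \<gamma>' s) \<in> borel_measurable lborel"
      using integrable_bounded_linear[OF bounded_linear_vec_nth f, of k] \<gamma>'
      by (intro borel_measurable_scaleR) auto
    show "AE s in lborel. norm ((f s $ k) *\<^sub>R \<gamma>' s) \<le> norm (\<Gamma> * norm (f s))"
    proof (rule AE_I2)
      fix s
      have "\<bar>f s $ k\<bar> * norm (\<gamma>' s) \<le> norm (f s) * \<bar>\<Gamma>\<bar>"
        using \<Gamma> by (intro mult_mono component_le_norm_cart)
          (auto simp: \<gamma>'_def indicator_def split: if_splits)
      then show "norm ((f s $ k) *\<^sub>R \<gamma>' s) \<le> norm (\<Gamma> * norm (f s))"
        by (simp add: abs_mult mult.commute)
    qed
  qed
  moreover have "(f s $ k) *\<^sub>R \<gamma>' s = indicator {0..S} s *\<^sub>R ((b s (x s) $ k) *\<^sub>R \<gamma> s)" for s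
    by (simp add: f_def \<gamma>'_def indicator_def)
  ultimately have "set_integrable lborel {0..S} (\<lambda>s. (b s (x s) $ k) *\<^sub>R \<gamma> s)"
    by (simp add: set_integrable_def)
  then show ?thesis by (rule set_borel_integral_eq_integral)
qed

lemma perturbed_normal_component:
  assumes p: "perturbed_solution r g x" and t: "t \<in> {0..\<tau>}"
  shows "(\<lambda>s. b s (x s) $ k) integrable_on {0..t}"
    "x t $ k = integral {0..t} (\<lambda>s. b s (x s) $ k) + g t $ k"
proof -
  have "((\<lambda>s. b s (x s) $ k) has_integral integral {0..t} (\<lambda>s. b s (x s)) $ k) {0..t}"
    using has_integral_linear[OF integrable_integral[OF perturbed_solutionD(1)[OF p t]] bounded_linear_vec_nth[of k]]
    by (simp add: o_def)
  then show "(\<lambda>s. b s (x s) $ k) integrable_on {0..t}"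
    "x t $ k = integral {0..t} (\<lambda>s. b s (x s) $ k) + g t $ k"
    using perturbed_solutionD(2)[OF p t] x0 by (auto simp: integral_unique)
qed

lemma perturbation_nonneg: "perturbed_solution r g x \<Longrightarrow> r \<ge> 0"
  using perturbed_solutionD(3)[of r g x 0] \<tau> order_trans[OF norm_ge_zero[of "g 0"]] by auto

lemma deviation_continuous:
  assumes "perturbed_solution r g x" "t \<le> \<tau>" "a \<ge> 0"
  shows "continuous_on {a..t} (\<lambda>s. norm (x s - X0 s))"
  using assms X0_continuous
  by (intro continuous_intros) (auto simp: perturbed_solution_def intro: continuous_on_subset)

text \<open>The integral equals \<open>x t $ k - g t $ k\<close>; the inward drift keeps the first
  term of order \<open>r\<close>, and the second is at most \<open>r\<close>.\<close>

lemma normal_drift_integral_small: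
  assumes p: "perturbed_solution r g x" and t: "t \<in> {0..\<tau>}"
    and ball: "\<And>s. s \<in> {0..t} \<Longrightarrow> norm (x s - x0) < \<delta>"
  shows "\<bar>integral {0..t} (\<lambda>s. b s (x s) $ k)\<bar> \<le> (3 * exp (L * t) + 1) * r"
proof -
  have g: "\<bar>g s $ k\<bar> \<le> r" if "s \<in> {0..t}" for s
    using perturbed_solutionD(3)[OF p, of s] component_le_norm_cart[of "g s" k] that t by auto
  have "continuous_on {0..t} (\<lambda>s. x s $ k)"
    using p t unfolding perturbed_solution_def
    by (auto intro!: continuous_on_component intro: continuous_on_subset)
  then have "\<bar>x t $ k\<bar> \<le> 3 * r * exp (L * t)"
  proof (rule abs_bound_if_drift_inward[OF _ perturbed_normal_component(1)[OF p t] _ _ L])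
    show "sgn (x s $ k) * b s (x s) $ k \<le> L * \<bar>x s $ k\<bar>" if "s \<in> {0..t}" for s
      using that t ball by (intro drift_inward) auto
  qed (use perturbed_normal_component(2)[OF p] t g in auto)
  then show ?thesis
    using perturbed_normal_component(2)[OF p t] g[of t] t by (auto simp: algebra_simps)
qed

section \<open>Stability while the limit path stays in the open ball\<close>

text \<open>A continuation argument: as long as the deviation is at most \<open>\<eta>1\<close>, the
  path \<open>x\<close> is in the ball, and averaging with Gronwall improves the bound to
  \<open>\<eta>1 / 2\<close>. By continuity the level \<open>\<eta>1\<close> is never
  reached.\<close>

lemma sliding_estimate:
  assumes S: "S \<in> {0..\<tau>}" and ball: "\<And>t. t \<in> {0..S} \<Longrightarrow> norm (X0 t - x0) < \<delta>"
    and \<eta>: "\<eta> > 0"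
  obtains r where "r > 0"
    "\<And>r' g x t. r' \<le> r \<Longrightarrow> perturbed_solution r' g x \<Longrightarrow> t \<in> {0..S} \<Longrightarrow> norm (x t - X0 t) \<le> \<eta>"
proof -
  have "continuous_on {0..S} (\<lambda>t. norm (X0 t - x0))"
    using X0_continuous S by (intro continuous_intros) (auto intro: continuous_on_subset)
  then obtain t1 where t1: "t1 \<in> {0..S}" "\<And>t. t \<in> {0..S} \<Longrightarrow> norm (X0 t - x0) \<le> norm (X0 t1 - x0)"
    using continuous_attains_sup[of "{0..S}" "\<lambda>t. norm (X0 t - x0)"] S by auto
  \<comment> \<open>A deviation of at most \<open>\<eta>1\<close> keeps \<open>x\<close> strictly
    inside the ball, as \<open>X0\<close> is farthest from \<open>x0\<close> at
    \<open>t1\<close>.\<close>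
  define \<eta>1 where "\<eta>1 = min \<eta> ((\<delta> - norm (X0 t1 - x0)) / 2)"
  have \<eta>1: "\<eta>1 > 0" "\<eta>1 \<le> \<eta>" "\<eta>1 < \<delta> - norm (X0 t1 - x0)"
    using \<eta> ball[OF t1(1)] by (auto simp: \<eta>1_def min_def)
  have cont: "continuous_on {0..S} \<gamma>" using gamma_continuous[OF S] ball by blast
  have "bounded (\<gamma> ` {0..S})"
    using cont by (intro compact_imp_bounded compact_continuous_image) auto
  then obtain \<Gamma> where \<Gamma>: "\<Gamma> > 0" "\<forall>s\<in>{0..S}. norm (\<gamma> s) \<le> \<Gamma>"
    unfolding bounded_pos by auto
  obtain B where B: "B > 0" "\<And>t. t \<in> {0..\<tau>} \<Longrightarrow> norm (bp t (X0 t)) \<le> B"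
    "\<And>t. t \<in> {0..\<tau>} \<Longrightarrow> norm (bm t (X0 t)) \<le> B"
    using bounded_along_X0 by blast
  define K where "K = (1 + \<Gamma>) * L"
  \<comment> \<open>Perturbation and averaged term each contribute at most \<open>\<beta>\<close>;
    after the Gronwall factor their sum is \<open>\<eta>1 / 2\<close>.\<close>
  define \<beta> where "\<beta> = \<eta>1 / (4 * exp (K * S))"
  have K: "K \<ge> 0" using \<Gamma> L by (simp add: K_def)
  have \<beta>: "\<beta> > 0" using \<eta>1 by (simp add: \<beta>_def)
  have "S \<ge> 0" using S by simp
  moreover have "L * \<eta>1 + B \<ge> 0" using L \<eta>1 B by simp
  ultimately obtain \<rho> where \<rho>: "\<rho> > 0" and average:
    "\<And>h t. t \<in> {0..S} \<Longrightarrow> h integrable_on {0..t} \<Longrightarrow> (\<lambda>s. h s *\<^sub>R \<gamma> s) integrable_on {0..t} \<Longrightarrow>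
       (\<And>s. s \<in> {0..t} \<Longrightarrow> \<bar>h s\<bar> \<le> L * \<eta>1 + B) \<Longrightarrow>
       (\<And>s. s \<in> {0..t} \<Longrightarrow> \<bar>integral {0..s} h\<bar> \<le> \<rho>) \<Longrightarrow>
       norm (integral {0..t} (\<lambda>s. h s *\<^sub>R \<gamma> s)) \<le> \<beta>"
    by (rule integral_scaleR_small[OF cont _ _ \<beta>]) blast+
  define C where "C = 3 * exp (L * S) + 1"
  have C: "C > 0" by (simp add: C_def add_pos_pos)
  \<comment> \<open>\<open>C * r\<close> bounds the integrals of the normal drift and must not
    exceed the \<open>\<rho>\<close> of the averaging lemma.\<close>
  define r where "r = min (\<rho> / C) \<beta>"
  have r: "r > 0" "r \<le> \<beta>" "C * r \<le> \<rho>"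
    using \<rho> \<beta> C by (auto simp: r_def min_def field_simps)
  show ?thesis
  proof (rule that[OF r(1)])
    fix r' g x t assume r': "r' \<le> r" and p: "perturbed_solution r' g x" and t: "t \<in> {0..S}"
    define u where "u s = norm (x s - X0 s)" for s
    have u_cont: "continuous_on {0..s} u" if "s \<le> S" for s
      unfolding u_def using that S by (intro deviation_continuous[OF p]) auto
    have improve: "u s \<le> \<eta>1 / 2" if s: "s \<in> {0..S}" and le: "\<And>q. q \<in> {0..s} \<Longrightarrow> u q \<le> \<eta>1" for s
    proof -
      have ball': "norm (x q - x0) < \<delta>" if "q \<in> {0..s}" for q
        using norm_triangle_ineq[of "x q - X0 q" "X0 q - x0"] le[OF that] t1(2)[of q] \<eta>1 s that
        by (auto simp: u_def)
      have h_bound: "\<bar>b q (x q) $ k\<bar> \<le> L * \<eta>1 + B" if q: "q \<in> {0..s}" for q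
      proof -
        have q': "q \<in> {0..\<tau>}" using q s S by auto
        have "norm (b q (x q)) \<le> L * u q + B"
          using glued_drift_near[of q "x q" "X0 q"] B(2,3)[OF q'] q
            norm_triangle_sub[of "b q (x q)" "bp q (X0 q)"] norm_triangle_sub[of "b q (x q)" "bm q (X0 q)"]
          by (auto simp: u_def)
        also have "\<dots> \<le> L * \<eta>1 + B" using le[OF q] L by (auto intro: mult_left_mono)
        finally show ?thesis using component_le_norm_cart[of "b q (x q)" k] by simp
      qed
      have H: "\<bar>integral {0..q} (\<lambda>s. b s (x s) $ k)\<bar> \<le> \<rho>" if q: "q \<in> {0..s}" for q
      proof -
        have "\<bar>integral {0..q} (\<lambda>s. b s (x s) $ k)\<bar> \<le> (3 * exp (L * q) + 1) * r'"
          using q s S ball' by (intro normal_drift_integral_small[OF p]) auto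
        also have "\<dots> \<le> C * r"
          using q s L r' perturbation_nonneg[OF p] unfolding C_def
          by (intro mult_mono add_mono) (auto intro!: mult_left_mono add_nonneg_nonneg)
        finally show ?thesis using r by simp
      qed
      have "u q \<le> (r + \<beta>) + K * integral {0..q} u" if q: "q \<in> {0..s}" for q
      proof -
        have q': "q \<in> {0..\<tau>}" "q \<in> {0..S}" using q s S by auto
        have g_int: "(\<lambda>s. (b s (x s) $ k) *\<^sub>R \<gamma> s) integrable_on {0..q}"
          using normal_drift_gamma_integrable[OF p q'(1)] continuous_on_subset[OF cont, of "{0..q}"] q'(2)
          by auto
        have avg: "norm (integral {0..q} (\<lambda>s. (b s (x s) $ k) *\<^sub>R \<gamma> s)) \<le> \<beta>"
          using perturbed_normal_component(1)[OF p q'(1)] h_bound H q g_int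
          by (intro average q'(2)) auto
        have main: "norm (integral {0..q} (\<lambda>s. b s (x s) - F s + (b s (x s) $ k) *\<^sub>R \<gamma> s)) \<le>
            integral {0..q} (\<lambda>s. K * u s)"
        proof (rule integral_norm_bound_integral)
          show "(\<lambda>s. b s (x s) - F s + (b s (x s) $ k) *\<^sub>R \<gamma> s) integrable_on {0..q}"
            using diff_X0(1)[OF p q'(1)] g_int by (rule integrable_add)
          show "(\<lambda>s. K * u s) integrable_on {0..q}"
            using u_cont q' by (intro integrable_continuous_real continuous_intros) auto
          fix v assume v: "v \<in> {0..q}"
          have "norm (b v (x v) - F v + (b v (x v) $ k) *\<^sub>R \<gamma> v) \<le> (1 + norm (\<gamma> v)) * L * u v"
            unfolding u_def using v q' S ball[of v] by (intro drift_decomposition) auto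
          also have "\<dots> \<le> K * u v"
            unfolding K_def using \<Gamma>(2) v q' L by (intro mult_right_mono) (auto simp: u_def)
          finally show "norm (b v (x v) - F v + (b v (x v) $ k) *\<^sub>R \<gamma> v) \<le> K * u v" .
        qed
        \<comment> \<open>The normal drift times \<open>\<gamma>\<close> is added and subtracted:
          with it the integrand is controlled by the deviation, and alone it averages out.\<close>
        have "x q - X0 q = integral {0..q} (\<lambda>s. b s (x s) - F s + (b s (x s) $ k) *\<^sub>R \<gamma> s)
            - integral {0..q} (\<lambda>s. (b s (x s) $ k) *\<^sub>R \<gamma> s) + g q"
          using diff_X0(2)[OF p q'(1)]
            Henstock_Kurzweil_Integration.integral_add[OF diff_X0(1)[OF p q'(1)] g_int] by simp
        then have "u q \<le> integral {0..q} (\<lambda>s. K * u s) + \<beta> + r"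
          unfolding u_def
          using main avg perturbed_solutionD(3)[OF p q'(1)] r'
          by (auto simp: u_def intro!: norm_triangle_le norm_triangle_le_diff add_mono)
        then show ?thesis by simp
      qed
      from gronwall[OF u_cont K this, of s s] s have "u s \<le> (r + \<beta>) * exp (K * s)" by auto
      also have "\<dots> \<le> (2 * \<beta>) * exp (K * S)"
        using r s K \<beta> by (intro mult_mono) (auto intro!: mult_left_mono)
      also have "\<dots> = \<eta>1 / 2" by (simp add: \<beta>_def)
      finally show ?thesis .
    qed
    show "norm (x t - X0 t) \<le> \<eta>"
    proof (rule ccontr)
      assume "\<not> norm (x t - X0 t) \<le> \<eta>"
      then have ut: "u t \<ge> \<eta>1" using \<eta>1 by (simp add: u_def)
      \<comment> \<open>Its least element \<open>R\<close> is the first time the deviation reaches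
        \<open>\<eta>1\<close>.\<close>
      define Z where "Z = {s \<in> {0..S}. \<eta>1 \<le> u s}"
      have "closed Z"
        unfolding Z_def using continuous_closed_preimage[OF u_cont[of S], of "{\<eta>1..}"]
        by (auto simp: vimage_def Int_def)
      moreover have "bounded Z" unfolding Z_def by (rule bounded_subset[OF bounded_closed_interval[of 0 S]]) auto
      ultimately have "compact Z" by (simp add: compact_eq_bounded_closed)
      moreover have "t \<in> Z" using t ut by (auto simp: Z_def)
      ultimately obtain R where R: "R \<in> Z" and Rmin: "\<And>s. s \<in> Z \<Longrightarrow> R \<le> s"
        using compact_attains_inf[of Z] by blast
      have RS: "R \<in> {0..S}" "u R \<ge> \<eta>1" using R by (auto simp: Z_def)
      have "u 0 \<le> r'" using diff_X0(2)[OF p, of 0] perturbed_solutionD(3)[OF p, of 0] \<tau> by (simp add: u_def)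
      also have "r' \<le> \<beta>" using r r' by simp
      also have "\<beta> \<le> \<eta>1"
      proof -
        have "exp (K * S) \<ge> 1" using K S by simp
        then have "1 \<le> 4 * exp (K * S)" by linarith
        then have "\<eta>1 * 1 \<le> \<eta>1 * (4 * exp (K * S))" using \<eta>1 by (intro mult_left_mono) auto
        then show ?thesis by (simp add: \<beta>_def field_simps)
      qed
      finally have "u 0 \<le> \<eta>1" .
      \<comment> \<open>The value \<open>\<eta>1\<close> is attained, by minimality at
        \<open>R\<close> itself, so \<open>improve\<close> applies on all of \<open>{0..R}\<close>
        and contradicts \<open>u R \<ge> \<eta>1\<close>.\<close>
      then obtain q where q: "0 \<le> q" "q \<le> R" "u q = \<eta>1"
        using IVT'[of u 0 \<eta>1 R] RS u_cont[of R] by auto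
      then have "q = R" using Rmin[of q] RS by (auto simp: Z_def)
      have "u s \<le> \<eta>1" if "s \<in> {0..R}" for s
      proof (cases "s = R")
        case False
        then show ?thesis using Rmin[of s] that RS by (force simp: Z_def not_le)
      qed (use q \<open>q = R\<close> in simp)
      from improve[OF RS(1) this] RS(2) \<eta>1 show False by simp
    qed
  qed
qed

section \<open>The remaining interval up to the exit time\<close>

text \<open>No cancellation is used here: the glued drift is at most \<open>B\<close> up to the
  Lipschitz term and the limit drift at most \<open>2 * B\<close>, hence \<open>3 * B\<close>. The
  \<open>2 * r\<close> bounds \<open>g q - g S\<close>.\<close>

lemma crude_estimate:
  assumes B: "\<And>t. t \<in> {0..\<tau>} \<Longrightarrow> norm (bp t (X0 t)) \<le> B"
    "\<And>t. t \<in> {0..\<tau>} \<Longrightarrow> norm (bm t (X0 t)) \<le> B"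
    and p: "perturbed_solution r g x" and S: "S \<in> {0..\<tau>}" and t: "t \<in> {S..\<tau>}"
  shows "norm (x t - X0 t) \<le>
    (norm (x S - X0 S) + 2 * r + 3 * B * (\<tau> - S)) * exp (L * (t - S))"
proof (rule gronwall[where u = "\<lambda>s. norm (x s - X0 s)", OF _ L _ t])
  show cont: "continuous_on {S..\<tau>} (\<lambda>s. norm (x s - X0 s))"
    using S by (intro deviation_continuous[OF p]) auto
  fix q assume q: "q \<in> {S..\<tau>}"
  have q': "q \<in> {0..\<tau>}" using q S by auto
  have B0: "B \<ge> 0" using B(1)[of 0] \<tau> order_trans[OF norm_ge_zero] by auto
  have i: "(\<lambda>s. b s (x s) - F s) integrable_on {S..q}"
    using diff_X0(1)[OF p q'] S by (auto intro: integrable_on_subinterval)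
  have u: "(\<lambda>s. norm (x s - X0 s)) integrable_on {S..q}"
    using cont q by (intro integrable_continuous_real) (auto intro: continuous_on_subset)
  have "norm (integral {S..q} (\<lambda>s. b s (x s) - F s)) \<le>
      integral {S..q} (\<lambda>s. L * norm (x s - X0 s) + 3 * B)"
  proof (rule integral_norm_bound_integral[OF i])
    show "(\<lambda>s. L * norm (x s - X0 s) + 3 * B) integrable_on {S..q}"
      using integrable_on_cmult_left[OF u, of L] by (intro integrable_add) auto
    fix s assume s: "s \<in> {S..q}"
    then have s': "s \<in> {0..\<tau>}" using q S by auto
    have "norm (b s (x s)) \<le> L * norm (x s - X0 s) + B"
      using glued_drift_near[of s "x s" "X0 s"] B[OF s'] s'
        norm_triangle_sub[of "b s (x s)" "bp s (X0 s)"] norm_triangle_sub[of "b s (x s)" "bm s (X0 s)"]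
      by auto
    then show "norm (b s (x s) - F s) \<le> L * norm (x s - X0 s) + 3 * B"
      using norm_triangle_ineq4[of "b s (x s)" "F s"] norm_limit_drift_le[of s "X0 s"] B[OF s'] by simp
  qed
  also have "\<dots> = L * integral {S..q} (\<lambda>s. norm (x s - X0 s)) + 3 * B * (q - S)"
    using q integrable_on_cmult_left[OF u, of L]
    by (subst Henstock_Kurzweil_Integration.integral_add) auto
  also have "\<dots> \<le> L * integral {S..q} (\<lambda>s. norm (x s - X0 s)) + 3 * B * (\<tau> - S)"
    using q B0 by (intro add_left_mono mult_left_mono) auto
  finally have n: "norm (integral {S..q} (\<lambda>s. b s (x s) - F s)) \<le>
    L * integral {S..q} (\<lambda>s. norm (x s - X0 s)) + 3 * B * (\<tau> - S)" .
  have "x q - X0 q = (x S - X0 S) + integral {S..q} (\<lambda>s. b s (x s) - F s) + g q - g S"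
    using diff_X0(2)[OF p q'] diff_X0(2)[OF p S]
      Henstock_Kurzweil_Integration.integral_combine[OF _ _ diff_X0(1)[OF p q'], of S] q S by auto
  also have "norm \<dots> \<le> norm (x S - X0 S) + norm (integral {S..q} (\<lambda>s. b s (x s) - F s))
      + norm (g q) + norm (g S)"
    by (intro order_trans[OF norm_triangle_ineq4] order_trans[OF norm_triangle_ineq] add_mono order_refl)
  finally show "norm (x q - X0 q) \<le> norm (x S - X0 S) + 2 * r + 3 * B * (\<tau> - S)
      + L * integral {S..q} (\<lambda>s. norm (x s - X0 s))"
    using n perturbed_solutionD(3)[OF p q'] perturbed_solutionD(3)[OF p S] by simp
qed

theorem perturbed_solution_close:
  assumes \<eta>: "\<eta> > 0"
  obtains r where "r > 0"
    "\<And>g x t. perturbed_solution r g x \<Longrightarrow> t \<in> {0..\<tau>} \<Longrightarrow> norm (x t - X0 t) \<le> \<eta>"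
proof -
  obtain B where B: "B > 0" "\<And>t. t \<in> {0..\<tau>} \<Longrightarrow> norm (bp t (X0 t)) \<le> B"
    "\<And>t. t \<in> {0..\<tau>} \<Longrightarrow> norm (bm t (X0 t)) \<le> B"
    using bounded_along_X0 by blast
  define E where "E = exp (L * \<tau>)"
  have E: "E \<ge> 1" using L \<tau> by (simp add: E_def)
  \<comment> \<open>Chosen so that \<open>3 * B * \<kappa> = \<eta> / (4 * E)\<close>; the deviation
    at \<open>S\<close> and \<open>2 * r\<close> get the same share, giving
    \<open>3 / 4 * \<eta>\<close> after the factor \<open>E\<close>.\<close>
  define \<kappa> where "\<kappa> = \<eta> / (12 * B * E)"
  have \<kappa>: "\<kappa> > 0" using \<eta> B E by (simp add: \<kappa>_def)
  define S where "S = max 0 (\<tau> - \<kappa>)"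
  have S: "S \<in> {0..\<tau>}" "\<tau> - S \<le> \<kappa>" using \<kappa> \<tau> by (auto simp: S_def)
  have ball: "norm (X0 t - x0) < \<delta>" if "t \<in> {0..S}" for t
  proof (cases "t < \<tau>")
    case False
    \<comment> \<open>As \<open>\<kappa> > 0\<close>, \<open>S\<close> can equal
      \<open>\<tau>\<close> only if both are 0, and then \<open>X0\<close> is still at
      \<open>x0\<close>.\<close>
    then have "t = 0" using that \<kappa> S by (auto simp: S_def max_def split: if_splits)
    then show ?thesis using X0_eq(2)[of 0] \<tau> \<delta> by simp
  qed (use inside that in auto)
  have "\<eta> / (4 * E) > 0" using \<eta> E by simp
  from sliding_estimate[OF S(1) ball this] obtain r1 where r1: "r1 > 0"
    "\<And>r' g x t. r' \<le> r1 \<Longrightarrow> perturbed_solution r' g x \<Longrightarrow> t \<in> {0..S} \<Longrightarrow>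
       norm (x t - X0 t) \<le> \<eta> / (4 * E)"
    by blast
  define r where "r = min r1 (\<eta> / (8 * E))"
  have r: "r > 0" "r \<le> r1" "r \<le> \<eta> / (8 * E)" using r1(1) \<eta> E by (auto simp: r_def)
  show ?thesis
  proof (rule that[OF r(1)])
    fix g x t assume p: "perturbed_solution r g x" and t: "t \<in> {0..\<tau>}"
    note est = r1(2)[OF r(2) p]
    show "norm (x t - X0 t) \<le> \<eta>"
    proof (cases "t \<le> S")
      case True
      then have "norm (x t - X0 t) \<le> \<eta> / (4 * E)" using est t by auto
      also have "\<dots> \<le> \<eta>" using \<eta> E by (simp add: divide_le_eq)
      finally show ?thesis .
    next
      case False
      have "norm (x t - X0 t) \<le>
          (norm (x S - X0 S) + 2 * r + 3 * B * (\<tau> - S)) * exp (L * (t - S))"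
        using False t by (intro crude_estimate[OF B(2,3) p S(1)]) auto
      also have "\<dots> \<le> (\<eta> / (4 * E) + 2 * (\<eta> / (8 * E)) + 3 * B * \<kappa>) * E"
        unfolding E_def using est[of S] r S B t L False
        by (intro mult_mono add_mono) (auto simp: E_def intro!: mult_left_mono add_nonneg_nonneg)
      also have "\<dots> = 3 / 4 * \<eta>"
        using B E by (simp add: \<kappa>_def field_simps)
      finally show ?thesis using \<eta> by simp
    qed
  qed
qed

end

section \<open>Checking the assumptions of the deterministic setting\<close>

lemma stop_time_bounds: "stop_time \<delta> x0 f T \<in> {0..T}"
  and norm_less_before_stop_time: "t \<in> {0..<stop_time \<delta> x0 f T} \<Longrightarrow> norm (f t - x0) < \<delta>"
  if T: "T \<ge> 0"
proof -
  have e0: "exit_time \<delta> x0 f \<ge> 0"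
    unfolding exit_time_def by (intro Inf_greatest) auto
  define m where "m = min (exit_time \<delta> x0 f) (ereal T)"
  have m: "0 \<le> m" "m \<le> ereal T" using e0 T by (auto simp: m_def)
  then have fin: "ereal (stop_time \<delta> x0 f T) = m"
    by (cases m) (auto simp: stop_time_def simp flip: m_def)
  then show "stop_time \<delta> x0 f T \<in> {0..T}" using m by (auto simp flip: fin)
  assume t: "t \<in> {0..<stop_time \<delta> x0 f T}"
  then have "ereal t < m" by (simp flip: fin)
  then have "ereal t < exit_time \<delta> x0 f" by (simp add: m_def)
  then have "t \<notin> {t. t \<ge> 0 \<and> norm (f t - x0) \<ge> \<delta>}"
    unfolding exit_time_def by (meson Inf_lower image_eqI leD)
  then show "norm (f t - x0) < \<delta>" using t by auto
qed

text \<open>The point \<open>v\<close> is approached along the normal from the side given by the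
  sign of \<open>\<sigma>\<close>; nearby points stay in the ball because \<open>v\<close> is in its
  interior, and the bound passes to the limit.\<close>

lemma one_sided_bound_on_hyperplane:
  fixes \<phi> :: "real ^ 'd::finite \<Rightarrow> real"
  assumes cont: "continuous_on UNIV \<phi>" and \<sigma>: "\<sigma> \<noteq> 0"
    and le: "\<And>x. \<sigma> * x $ k > 0 \<Longrightarrow> norm (x - x0) \<le> \<delta> \<Longrightarrow> \<phi> x \<le> a"
    and v: "v $ k = 0" "norm (v - x0) < \<delta>"
  shows "\<phi> v \<le> a"
proof -
  define z where "z h = v + h *\<^sub>R axis k \<sigma>" for h
  have z: "(z \<longlongrightarrow> v) (at_right 0)" unfolding z_def by (auto intro!: tendsto_eq_intros)
  have "((\<lambda>h. \<phi> (z h)) \<longlongrightarrow> \<phi> v) (at_right 0)"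
    using cont z by (auto simp: continuous_on_eq_continuous_at intro: isCont_tendsto_compose)
  moreover have "\<forall>\<^sub>F h in at_right 0. norm (z h - x0) < \<delta>"
    using z v(2) by (intro order_tendstoD(2)[of _ "norm (v - x0)"] tendsto_intros) auto
  then have "\<forall>\<^sub>F h in at_right 0. \<phi> (z h) \<le> a"
    using eventually_at_right_less[of 0]
  proof eventually_elim
    case (elim h)
    then show ?case using \<sigma> v
      by (intro le) (auto simp: z_def zero_less_mult_iff mult_less_0_iff linorder_neq_iff)
  qed
  ultimately show ?thesis by (intro tendsto_upperbound) auto
qed

text \<open>\<open>cond_A3\<close> yields both one-sided bounds, hence a gap of even
  \<open>2 * c\<close>; each other condition yields one bound and one vanishing component.\<close>

lemma inward_on_hyperplane:
  fixes bp bm :: "real \<Rightarrow> real ^ 'd \<Rightarrow> real ^ 'd::finite"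
  assumes cont: "continuous_on UNIV (bp t)" "continuous_on UNIV (bm t)" and c: "c > 0"
    and cond: "cond_A3 k bp bm x0 T \<delta> c \<or> cond_A3_plus k bp bm x0 T \<delta> c
           \<or> cond_A3_minus k bp bm x0 T \<delta> c"
    and t: "t \<in> {0..T}" and v: "v $ k = 0" "norm (v - x0) < \<delta>"
  shows "bp t v $ k \<le> 0 \<and> 0 \<le> bm t v $ k \<and> c \<le> bm t v $ k - bp t v $ k"
proof -
  have p: "bp t v $ k \<le> - c" if "\<And>x. x $ k > 0 \<Longrightarrow> norm (x - x0) \<le> \<delta> \<Longrightarrow> bp t x $ k \<le> - c"
    using one_sided_bound_on_hyperplane[of "\<lambda>x. bp t x $ k" 1 k x0 \<delta> "- c" v] cont(1) that v
    by (auto intro: continuous_on_component)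
  have "continuous_on UNIV (\<lambda>x. - (bm t x $ k))"
    using cont(2) by (intro continuous_on_minus continuous_on_component)
  then have m: "bm t v $ k \<ge> c" if "\<And>x. x $ k < 0 \<Longrightarrow> norm (x - x0) \<le> \<delta> \<Longrightarrow> bm t x $ k \<ge> c"
    using one_sided_bound_on_hyperplane[of "\<lambda>x. - (bm t x $ k)" "-1" k x0 \<delta> "- c" v] that v by auto
  from cond show ?thesis
  proof (elim disjE)
    assume A: "cond_A3 k bp bm x0 T \<delta> c"
    have A': "sgn (x $ k) * glued_drift k bp bm t x $ k \<le> - c"
      if "x $ k \<noteq> 0" "norm (x - x0) \<le> \<delta>" for x
      using A t that by (auto simp: cond_A3_def hyperplane_def)
    have "bp t x $ k \<le> - c" if "x $ k > 0" "norm (x - x0) \<le> \<delta>" for x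
      using A'[of x] that by (simp add: glued_drift_def)
    moreover have "bm t x $ k \<ge> c" if "x $ k < 0" "norm (x - x0) \<le> \<delta>" for x
      using A'[of x] that by (simp add: glued_drift_def)
    ultimately show ?thesis using p m c by fastforce
  next
    assume A: "cond_A3_plus k bp bm x0 T \<delta> c"
    then have "bp t v $ k \<le> - c" using t by (intro p) (auto simp: cond_A3_plus_def)
    moreover have "bm t v $ k = 0" using A t v by (auto simp: cond_A3_plus_def hyperplane_def)
    ultimately show ?thesis using c by simp
  next
    assume A: "cond_A3_minus k bp bm x0 T \<delta> c"
    then have "bm t v $ k \<ge> c" using t by (intro m) (auto simp: cond_A3_minus_def)
    moreover have "bp t v $ k = 0" using A t v by (auto simp: cond_A3_minus_def hyperplane_def)
    ultimately show ?thesis using c by simp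
  qed
qed

section \<open>From pathwise closeness to convergence in probability\<close>

text \<open>Dominated convergence: at almost every point the indicators are eventually 0.\<close>

lemma (in prob_space) prob_tendsto_0_if_eventually_not:
  assumes "AE \<omega> in M. \<forall>\<^sub>F n in sequentially. \<omega> \<notin> A n"
  shows "(\<lambda>n. measure M (A n)) \<longlonglongrightarrow> 0"
proof -
  text \<open>Sets that are not measurable have measure 0 by convention.\<close>
  define A' where "A' n = (if A n \<in> sets M then A n else {})" for n
  have A': "A' n \<in> sets M" "measure M (A n) = measure M (A' n)" for n
    by (auto simp: A'_def measure_notin_sets)
  have "(\<lambda>n. \<integral>\<omega>. indicator (A' n) \<omega> \<partial>M) \<longlonglongrightarrow> (\<integral>\<omega>. (0::real) \<partial>M)"
  proof (rule integral_dominated_convergence[where w = "\<lambda>_. 1"])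
    show "AE \<omega> in M. (\<lambda>n. indicator (A' n) \<omega>) \<longlonglongrightarrow> (0::real)"
      using assms
    proof eventually_elim
      case (elim \<omega>)
      then show ?case
        by (intro tendsto_eventually) (auto elim!: eventually_mono simp: A'_def)
    qed
  qed (use A' in \<open>auto simp: indicator_def\<close>)
  then show ?thesis using A' by simp
qed

theorem theorem4:
  fixes k :: "'d::finite"
    and bp bm :: "real \<Rightarrow> real ^ 'd \<Rightarrow> real ^ 'd"
    and x0 :: "real ^ 'd"
    and T \<delta> c :: real
    and M :: "'w measure"
    and w :: "real \<Rightarrow> 'w \<Rightarrow> real ^ 'd"
    and X :: "real \<Rightarrow> real \<Rightarrow> 'w \<Rightarrow> real ^ 'd"
    and X0 :: "real \<Rightarrow> real ^ 'd"
  defines "\<tau> \<equiv> stop_time \<delta> x0 X0 T"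
  assumes "drift_coeff bp" and "drift_coeff bm"
    and "wiener_process M w"
    and "\<And>\<epsilon>. \<epsilon> > 0 \<Longrightarrow> strong_solution M w (glued_drift k bp bm) x0 \<epsilon> (X \<epsilon>)"
    and "x0 \<in> hyperplane k"
    and "continuous_on ({0..} \<times> UNIV) (\<lambda>(t, x). bp t x)"
    and "continuous_on ({0..} \<times> UNIV) (\<lambda>(t, x). bm t x)"
    and "T > 0" and "\<delta> > 0" and "c > 0"
    and "cond_A3 k bp bm x0 T \<delta> c \<or> cond_A3_plus k bp bm x0 T \<delta> c
           \<or> cond_A3_minus k bp bm x0 T \<delta> c"
    and "limit_solution k bp bm x0 \<tau> X0"
  shows "converges_in_probability_C M
           (\<lambda>\<epsilon> t \<omega>. X \<epsilon> (min t \<tau>) \<omega>) (\<lambda>t \<omega>. X0 (min t \<tau>)) (at_right 0)"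
proof -
  obtain Lp Lm where Lp: "\<And>t. t \<ge> 0 \<Longrightarrow> Lp-lipschitz_on UNIV (bp t)"
    and Lm: "\<And>t. t \<ge> 0 \<Longrightarrow> Lm-lipschitz_on UNIV (bm t)"
    using assms(2,3) unfolding drift_coeff_def by blast
  define L where "L = max Lp Lm"
  have lip: "L-lipschitz_on UNIV (bp t)" "L-lipschitz_on UNIV (bm t)" if "t \<ge> 0" for t
    using Lp[OF that] Lm[OF that] by (auto simp: L_def intro: lipschitz_on_le)
  have \<tau>: "\<tau> \<in> {0..T}" unfolding \<tau>_def using assms(9) by (intro stop_time_bounds) simp
  interpret sliding k bp bm x0 \<delta> c L \<tau> X0
  proof
    show "norm (bp t x - bp t y) \<le> L * norm (x - y)" "norm (bm t x - bm t y) \<le> L * norm (x - y)"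
      if "t \<ge> 0" for t x y
      using lipschitz_onD[OF lip(1)[OF that], of x y] lipschitz_onD[OF lip(2)[OF that], of x y]
      by (simp_all add: dist_norm)
    show "L \<ge> 0" using lip(1)[of 0] by (auto dest: lipschitz_on_nonneg)
    show "bp t v $ k \<le> 0 \<and> 0 \<le> bm t v $ k \<and> c \<le> bm t v $ k - bp t v $ k"
      if "t \<in> {0..\<tau>}" "v $ k = 0" "norm (v - x0) < \<delta>" for t v
    proof (rule inward_on_hyperplane[OF _ _ assms(11,12) _ that(2,3)])
      show "continuous_on UNIV (bp t)" "continuous_on UNIV (bm t)"
        using that lip by (auto intro: lipschitz_on_continuous_on)
    qed (use that \<tau> in auto)
    show "norm (X0 t - x0) < \<delta>" if "t \<in> {0..<\<tau>}" for t
      using norm_less_before_stop_time[of T t \<delta> x0 X0] assms(9) that by (simp add: \<tau>_def)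
  qed (use assms \<tau> in \<open>auto simp: hyperplane_def\<close>)
  interpret prob_space M using assms(4) by (simp add: wiener_process_def)
  have stopped_path: "continuous_on {0..} (\<lambda>t. f (min t \<tau>))" if "continuous_on {0..\<tau>} f"
    for f :: "real \<Rightarrow> real ^ 'd"
    using \<tau> by (intro continuous_on_compose2[OF that]) (auto intro!: continuous_intros)
  have X_path: "continuous_on {0..} (\<lambda>t. X \<epsilon> t \<omega>)" if "\<epsilon> > 0" "\<omega> \<in> space M" for \<epsilon> \<omega>
    using assms(5)[OF that(1)] that(2) by (simp add: strong_solution_def random_path_def)
  have X_path': "continuous_on {0..\<tau>} (\<lambda>t. X \<epsilon> t \<omega>)" if "\<epsilon> > 0" "\<omega> \<in> space M" for \<epsilon> \<omega>
    using X_path[OF that] by (rule continuous_on_subset) auto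
  have "random_path M (\<lambda>t \<omega>. X \<epsilon> (min t \<tau>) \<omega>)" if "\<epsilon> > 0" for \<epsilon>
    using assms(5)[OF that] \<tau> stopped_path[OF X_path'[OF that]]
    by (auto simp: strong_solution_def random_path_def)
  then have "\<forall>\<^sub>F \<epsilon> in at_right 0. random_path M (\<lambda>t \<omega>. X \<epsilon> (min t \<tau>) \<omega>)"
    using eventually_at_right_less[of 0] by (rule eventually_mono[rotated])
  moreover have "random_path M (\<lambda>t \<omega>. X0 (min t \<tau>))"
    using stopped_path[OF X0_continuous] by (simp add: random_path_def)
  moreover have "((\<lambda>\<epsilon>. measure M {\<omega> \<in> space M. \<exists>t\<in>K. dist (X \<epsilon> (min t \<tau>) \<omega>) (X0 (min t \<tau>)) > \<eta>})
      \<longlongrightarrow> 0) (at_right 0)" if K: "K \<subseteq> {0..}" and \<eta>: "\<eta> > 0" for K \<eta>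
  proof (rule tendsto_at_right_sequentially[of 0 1])
    \<comment> \<open>Along a sequence the exceptional null sets are countably many, so almost every
      \<open>\<omega>\<close> satisfies all the equations at once.\<close>
    fix \<epsilon> :: "nat \<Rightarrow> real"
    assume \<epsilon>: "\<And>n. 0 < \<epsilon> n" "\<epsilon> \<longlonglongrightarrow> 0"
    \<comment> \<open>This \<open>r\<close> depends on neither \<open>\<omega>\<close> nor
      \<open>n\<close>.\<close>
    obtain r where r: "r > 0"
      "\<And>g x t. perturbed_solution r g x \<Longrightarrow> t \<in> {0..\<tau>} \<Longrightarrow> norm (x t - X0 t) \<le> \<eta>"
      using perturbed_solution_close[OF \<eta>] by blast
    have "AE \<omega> in M. \<forall>n. \<forall>t\<ge>0. set_integrable lborel {0..t} (\<lambda>s. b s (X (\<epsilon> n) s \<omega>)) \<and>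
        X (\<epsilon> n) t \<omega> = x0 + (LINT s:{0..t}|lborel. b s (X (\<epsilon> n) s \<omega>)) + \<epsilon> n *\<^sub>R w t \<omega>"
      using assms(5)[OF \<epsilon>(1)] by (simp add: strong_solution_def AE_all_countable)
    moreover have "AE \<omega> in M. continuous_on {0..} (\<lambda>t. w t \<omega>)"
      using assms(4) by (simp add: wiener_process_def)
    moreover have "AE \<omega> in M. \<omega> \<in> space M" by (rule AE_space)
    ultimately have "AE \<omega> in M. \<forall>\<^sub>F n in sequentially.
        \<omega> \<notin> {\<omega> \<in> space M. \<exists>t\<in>K. dist (X (\<epsilon> n) (min t \<tau>) \<omega>) (X0 (min t \<tau>)) > \<eta>}"
    proof eventually_elim
      case (elim \<omega>)
      note sol_\<omega> = elim(1) and \<omega> = elim(3)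
      have "continuous_on {0..\<tau>} (\<lambda>t. w t \<omega>)" using elim(2) by (rule continuous_on_subset) auto
      then have "bounded ((\<lambda>t. w t \<omega>) ` {0..\<tau>})"
        by (intro compact_imp_bounded compact_continuous_image) auto
      \<comment> \<open>The bound, and with it the index from which
        \<open>\<epsilon> n * W < r\<close> holds, may depend on \<open>\<omega>\<close>; almost
        sure eventual closeness suffices.\<close>
      then obtain W where W: "W > 0" "\<forall>t\<in>{0..\<tau>}. norm (w t \<omega>) \<le> W"
        unfolding bounded_pos by auto
      have "(\<lambda>n. \<epsilon> n * W) \<longlonglongrightarrow> 0" using \<epsilon>(2) by (auto intro: tendsto_eq_intros)
      then have "\<forall>\<^sub>F n in sequentially. \<epsilon> n * W < r" using r(1) by (rule order_tendstoD)
      then show ?case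
      proof eventually_elim
        case (elim n)
        have "norm (\<epsilon> n *\<^sub>R w t \<omega>) \<le> r" if "t \<in> {0..\<tau>}" for t
        proof -
          have "\<epsilon> n * norm (w t \<omega>) \<le> \<epsilon> n * W"
            using W(2) that \<epsilon>(1)[of n] by (intro mult_left_mono) auto
          also have "\<epsilon> n * W \<le> r" using elim by simp
          finally show ?thesis using \<epsilon>(1)[of n] by simp
        qed
        then have "perturbed_solution r (\<lambda>t. \<epsilon> n *\<^sub>R w t \<omega>) (\<lambda>t. X (\<epsilon> n) t \<omega>)"
          unfolding perturbed_solution_def using sol_\<omega> X_path'[OF \<epsilon>(1) \<omega>] by auto
        note close = r(2)[OF this]
        have "dist (X (\<epsilon> n) (min t \<tau>) \<omega>) (X0 (min t \<tau>)) \<le> \<eta>" if "t \<in> K" for t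
          using close[of "min t \<tau>"] K \<tau> that by (auto simp: dist_norm)
        then show ?case by (auto simp: not_less)
      qed
    qed
    then show "(\<lambda>n. measure M {\<omega> \<in> space M.
        \<exists>t\<in>K. dist (X (\<epsilon> n) (min t \<tau>) \<omega>) (X0 (min t \<tau>)) > \<eta>}) \<longlonglongrightarrow> 0"
      by (rule prob_tendsto_0_if_eventually_not)
  qed auto
  ultimately show ?thesis by (simp add: converges_in_probability_C_def)
qed

end
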